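(* There exists a non-pseudoconvex bounded domain $D\subset\mathbb C^2$ such that $\limsup_{D\ni z\to a}K_D(z)=\infty$ for every $a\in\partial D$.
   Context: A domain is a connected open set. For a domain $D\subset\mathbb C^n$, $L_h^2(D):=L^2(D)\cap\mathcal O(D)$ is the space of square-integrable (with respect to Lebesgue measure) holomorphic functions on $D$, and $K_D(z)$ denotes the Bergman kernel of $D$ on the diagonal, $K_D(z)=\sup\{|f(z)|^2: f\in L_h^2(D),\ \|f\|_{L^2(D)}\le 1\}$. *)

theory Defs
  imports "HOL-Analysis.Analysis"
begin

definition is_domain :: "'a::topological_space set \<Rightarrow> bool" where
  "is_domain D \<longleftrightarrow> open D \<and> connected D"

(* Frechet differentiability with a complex-linear derivative at every point;
   meant for open D. *)
definition holomorphic_several_on :: "(complex ^ 'n \<Rightarrow> complex) \<Rightarrow> (complex ^ 'n) set \<Rightarrow> bool" where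
  "holomorphic_several_on f D \<longleftrightarrow>
     (\<forall>z\<in>D. \<exists>f'. (f has_derivative f') (at z) \<and> (\<forall>c v. f' (c *s v) = c * f' v))"

(* Functions are total; their values outside D are irrelevant below. *)
definition L2h :: "(complex ^ 'n) set \<Rightarrow> (complex ^ 'n \<Rightarrow> complex) set" where
  "L2h D = {f. holomorphic_several_on f D \<and>
               set_integrable lebesgue D (\<lambda>z. (cmod (f z))\<^sup>2)}"

definition L2_norm_on :: "(complex ^ 'n) set \<Rightarrow> (complex ^ 'n \<Rightarrow> complex) \<Rightarrow> real" where
  "L2_norm_on D f = sqrt (LINT z:D|lebesgue. (cmod (f z))\<^sup>2)"

definition bergman_kernel :: "(complex ^ 'n) set \<Rightarrow> complex ^ 'n \<Rightarrow> ereal" where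
  "bergman_kernel D z =
     (SUP f\<in>{f \<in> L2h D. L2_norm_on D f \<le> 1}. ereal ((cmod (f z))\<^sup>2))"

(* Real-valued continuous subharmonic functions: the sub-mean value inequality
   over every circle bounding a closed disc in U. *)
definition continuous_subharmonic_on :: "(complex \<Rightarrow> real) \<Rightarrow> complex set \<Rightarrow> bool" where
  "continuous_subharmonic_on v U \<longleftrightarrow> continuous_on U v \<and>
     (\<forall>a r. r > 0 \<and> cball a r \<subseteq> U \<longrightarrow>
        v a \<le> integral {0..2 * pi} (\<lambda>t. v (a + of_real r * cis t)) / (2 * pi))"

definition continuous_plurisubharmonic_on :: "(complex ^ 'n \<Rightarrow> real) \<Rightarrow> (complex ^ 'n) set \<Rightarrow> bool" where
  "continuous_plurisubharmonic_on u D \<longleftrightarrow> continuous_on D u \<and>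
     (\<forall>z w. continuous_subharmonic_on (\<lambda>\<tau>. u (z + \<tau> *s w)) {\<tau>. z + \<tau> *s w \<in> D})"

(* Existence of a continuous plurisubharmonic exhaustion function. Allowing the
   value -\<infinity> would not change the notion (replace u by max u 0), so
   real-valued functions suffice. *)
definition pseudoconvex :: "(complex ^ 'n) set \<Rightarrow> bool" where
  "pseudoconvex D \<longleftrightarrow> open D \<and>
     (\<exists>u. continuous_plurisubharmonic_on u D \<and>
        (\<forall>c. compact (closure {z \<in> D. u z < c}) \<and> closure {z \<in> D. u z < c} \<subseteq> D))"

end

theory Submission
  imports Defs
begin

text \<open>
  The domain is the unit bidisc cut along the real hypersurface where \<open>z\<^sub>1\<close> is a nonnegative multiple
  of \<open>cis \<bar>z\<^sub>2\<bar>\<^sup>2\<close>. On it the argument of \<open>z\<^sub>1\<close> has a continuous branch with values between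
  \<open>\<bar>z\<^sub>2\<bar>\<^sup>2\<close> and \<open>\<bar>z\<^sub>2\<bar>\<^sup>2 + 2\<pi>\<close>, so the domain is a staircase whose two ends lie on the two sides of the
  same slit. Since \<open>\<bar>z\<^sub>2\<bar>\<^sup>2\<close> is strictly convex, the lower end is pseudoconvex and the upper end
  is pseudoconcave. Every slit point with \<open>z\<^sub>1 \<noteq> 0\<close> borders on both ends: its pseudoconcave side
  destroys pseudoconvexity of the domain, while its pseudoconvex side alone already makes the upper
  limit of the Bergman kernel infinite. The two sides do not interfere, because
  functions on the domain may depend on the branch of the argument.

  Blow-up at a boundary point follows from a holomorphic function of modulus below one whose modulus
  tends to one along some approach to the point: its powers keep their size there but tend to zero
  in norm (\<open>Limsup_bergman_kernel_eq_infinity\<close>). On the boundary of the bidisc a coordinate does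
  this. At a slit point over \<open>b\<close>, convexity of \<open>\<bar>z\<^sub>2\<bar>\<^sup>2\<close> gives the function
  \<open>exp (\<i> log z\<^sub>1 + 2 (cnj b) z\<^sub>2 - \<bar>b\<bar>\<^sup>2)\<close>, whose modulus depends only on the height above the slit
  and the distance of \<open>z\<^sub>2\<close> from \<open>b\<close> (\<open>norm_slit_peak\<close>).

  Pseudoconvexity fails by the continuity principle. The discs \<open>z\<^sub>1 = cis (-t) / 2\<close>,
  \<open>\<bar>z\<^sub>2\<bar> \<le> 1/2\<close> avoid the slit for small \<open>t > 0\<close>; as \<open>t\<close> tends to zero their boundary circles stay in
  a compact part of the domain, but their centres converge to a slit point. The sub-mean value
  inequality bounds an exhaustion function at the centres, which is impossible
  (\<open>not_pseudoconvex_slit_bidisc\<close>).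
\<close>

section \<open>Blow-up of the Bergman kernel from peak functions\<close>

lemma holomorphic_several_on_imp_continuous_on:
  assumes "holomorphic_several_on f D"
  shows "continuous_on D f"
  using assms unfolding holomorphic_several_on_def
  by (meson continuous_at_imp_continuous_on has_derivative_continuous)

lemma holomorphic_several_on_const_mult_power:
  assumes "holomorphic_several_on f D"
  shows "holomorphic_several_on (\<lambda>z. c * f z ^ n) D"
  unfolding holomorphic_several_on_def
proof
  fix z assume "z \<in> D"
  then obtain f' where f': "(f has_derivative f') (at z)" "\<And>c v. f' (c *s v) = c * f' v"
    using assms unfolding holomorphic_several_on_def by blast
  have "((\<lambda>z. c * f z ^ n) has_derivative (\<lambda>v. c * (of_nat n * f' v * f z ^ (n - 1)))) (at z)"
    using f'(1) by (auto intro!: derivative_eq_intros)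
  then show "\<exists>g'. ((\<lambda>z. c * f z ^ n) has_derivative g') (at z) \<and> (\<forall>c v. g' (c *s v) = c * g' v)"
    by (intro exI conjI) (auto simp: f'(2) mult_ac)
qed

lemma bounded_open_set_integrable:
  fixes f :: "complex ^ 'n \<Rightarrow> complex"
  assumes "open D" "bounded D" "continuous_on D f" "\<And>z. z \<in> D \<Longrightarrow> cmod (f z) \<le> B"
  shows "set_integrable lebesgue D (\<lambda>z. (cmod (f z))\<^sup>2)"
proof -
  have D: "D \<in> sets lebesgue" "D \<in> lmeasurable"
    using assms(1,2) by (auto intro: bounded_set_imp_lmeasurable)
  have meas: "set_borel_measurable lebesgue D (\<lambda>z. (cmod (f z))\<^sup>2)"
    unfolding set_borel_measurable_def
  proof -
    have "(\<lambda>z. indicator D z *\<^sub>R (cmod (f z))\<^sup>2) \<in> borel_measurable borel"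
      by (rule borel_measurable_continuous_on_indicator)
         (use assms(1,3) in \<open>auto intro!: borel_open continuous_on_power continuous_on_norm\<close>)
    then show "(\<lambda>z. indicator D z *\<^sub>R (cmod (f z))\<^sup>2) \<in> borel_measurable lebesgue"
      by (intro measurable_completion) simp
  qed
  have "set_integrable lebesgue D (\<lambda>z. B\<^sup>2)"
    using D by (auto simp: set_integrable_def fmeasurable_def less_top)
  then show ?thesis
    using meas
  proof (rule set_integrable_bound)
    show "AE z in lebesgue. z \<in> D \<longrightarrow> norm ((cmod (f z))\<^sup>2) \<le> norm (B\<^sup>2)"
      using assms(4) by (auto intro!: AE_I2 power_mono)
  qed
qed

lemma integral_powers_tendsto_0:
  fixes h :: "complex ^ 'n \<Rightarrow> complex"
  assumes "open D" "bounded D" "continuous_on D h" "\<And>z. z \<in> D \<Longrightarrow> cmod (h z) < 1"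
  shows "(\<lambda>n. LINT z:D|lebesgue. (cmod (h z ^ n))\<^sup>2) \<longlonglongrightarrow> 0"
proof -
  have D: "D \<in> sets lebesgue" "D \<in> lmeasurable"
    using assms(1,2) by (auto intro: bounded_set_imp_lmeasurable)
  have "(\<lambda>n. LINT z|lebesgue. indicator D z *\<^sub>R (cmod (h z ^ n))\<^sup>2)
          \<longlonglongrightarrow> (LINT z|(lebesgue :: (complex ^ 'n) measure). (0::real))"
  proof (rule integral_dominated_convergence[where w = "indicator D"])
    show "(\<lambda>z. indicator D z *\<^sub>R (cmod (h z ^ n))\<^sup>2) \<in> borel_measurable lebesgue" for n
    proof -
      have "set_integrable lebesgue D (\<lambda>z. (cmod (h z ^ n))\<^sup>2)"
        using assms by (intro bounded_open_set_integrable[where B = 1])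
          (auto intro!: continuous_intros power_le_one simp: norm_power less_imp_le)
      then show ?thesis by (simp add: set_integrable_def)
    qed
    show "integrable lebesgue (indicator D :: _ \<Rightarrow> real)"
      using D by (auto simp: fmeasurable_def less_top)
    show "AE z in lebesgue. (\<lambda>n. indicator D z *\<^sub>R (cmod (h z ^ n))\<^sup>2) \<longlonglongrightarrow> 0"
    proof (rule AE_I2)
      fix z :: "complex ^ 'n"
      show "(\<lambda>n. indicator D z *\<^sub>R (cmod (h z ^ n))\<^sup>2) \<longlonglongrightarrow> 0"
      proof (cases "z \<in> D")
        case True
        have "(\<lambda>n. (cmod (h z) ^ n)\<^sup>2) \<longlonglongrightarrow> 0\<^sup>2"
          using assms(4)[OF True] by (intro tendsto_intros LIMSEQ_realpow_zero) auto
        with True show ?thesis by (simp add: norm_power)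
      qed simp
    qed
    show "AE z in lebesgue. norm (indicator D z *\<^sub>R (cmod (h z ^ n))\<^sup>2) \<le> indicator D z" for n
      using assms(4) by (auto intro!: AE_I2 power_le_one simp: indicator_def norm_power less_imp_le)
  qed simp
  then show ?thesis by (simp add: set_lebesgue_integral_def)
qed

lemma bergman_kernel_ge:
  assumes "f \<in> L2h D" "(LINT z:D|lebesgue. (cmod (f z))\<^sup>2) \<le> 1"
  shows "ereal ((cmod (f z))\<^sup>2) \<le> bergman_kernel D z"
  unfolding bergman_kernel_def
  by (rule SUP_upper) (use assms in \<open>auto simp: L2_norm_on_def\<close>)

text \<open>Dominated convergence makes the powers of a peak function \<open>h\<close> tend to zero in norm, while
  near \<open>a\<close> each fixed power stays close to modulus one somewhere. Hence the quotient of the value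
  by the norm is unbounded. The approach to \<open>a\<close> is an arbitrary filter because at a boundary point
  that is accessible from two sides the peak occurs on one side only.\<close>

lemma Limsup_bergman_kernel_eq_infinity:
  fixes D :: "(complex ^ 'n) set"
  assumes D: "open D" "bounded D" and h: "holomorphic_several_on h D"
    and less: "\<And>z. z \<in> D \<Longrightarrow> cmod (h z) < 1"
    and F: "F \<noteq> bot" and g: "(g \<longlongrightarrow> a) F" "eventually (\<lambda>x. g x \<in> D) F"
    and peak: "((\<lambda>x. cmod (h (g x))) \<longlongrightarrow> 1) F" and a: "a \<notin> D"
  shows "Limsup (at a within D) (bergman_kernel D) = \<infinity>"
proof (rule ccontr)
  assume "Limsup (at a within D) (bergman_kernel D) \<noteq> \<infinity>"
  then obtain M where "Limsup (at a within D) (bergman_kernel D) < ereal M"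
    unfolding less_PInf_Ex_of_nat by blast
  then have "eventually (\<lambda>z. bergman_kernel D z < ereal M) (at a within D)"
    by (rule Limsup_lessD)
  moreover have "filterlim g (at a within D) F"
    unfolding filterlim_at using g a by (auto elim: eventually_mono)
  ultimately have small: "eventually (\<lambda>x. bergman_kernel D (g x) < ereal M) F"
    by (rule eventually_compose_filterlim)
  define \<delta> where "\<delta> = 1 / (2 * (\<bar>M\<bar> + 1))"
  have \<delta>: "\<delta> > 0" by (simp add: \<delta>_def add_nonneg_pos)
  have cont: "continuous_on D h"
    using h by (rule holomorphic_several_on_imp_continuous_on)
  have "eventually (\<lambda>n. (LINT z:D|lebesgue. (cmod (h z ^ n))\<^sup>2) < \<delta>) sequentially"
    using integral_powers_tendsto_0[OF D cont less] \<delta> by (rule order_tendstoD)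
  then obtain n where n: "(LINT z:D|lebesgue. (cmod (h z ^ n))\<^sup>2) < \<delta>"
    using eventually_happens'[OF sequentially_bot] by blast
  \<comment> \<open>Scaling by the bound \<open>sqrt \<delta>\<close> for the norm rather than by the norm itself avoids dividing by a possible zero.\<close>
  define f where "f = (\<lambda>z. of_real (1 / sqrt \<delta>) * h z ^ n)"
  have f_sq: "(cmod (f z))\<^sup>2 = (1 / \<delta>) * (cmod (h z ^ n))\<^sup>2" for z
    using \<delta> by (simp add: f_def norm_mult norm_divide power_mult_distrib power_divide)
  have f_hol: "holomorphic_several_on f D"
    unfolding f_def using h by (rule holomorphic_several_on_const_mult_power)
  have "cmod (f z) \<le> 1 / sqrt \<delta>" if "z \<in> D" for z
    using \<delta> less[OF that] by (simp add: f_def norm_mult norm_divide norm_power power_le_one divide_right_mono)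
  then have "f \<in> L2h D"
    unfolding L2h_def using f_hol
    by (auto intro!: bounded_open_set_integrable D holomorphic_several_on_imp_continuous_on)
  moreover have "(LINT z:D|lebesgue. (cmod (f z))\<^sup>2) \<le> 1"
    using n \<delta> by (simp add: f_sq)
  ultimately have ge: "ereal ((1 / \<delta>) * (cmod (h z ^ n))\<^sup>2) \<le> bergman_kernel D z" for z
    using bergman_kernel_ge[of f D z] by (simp only: f_sq)
  have "((\<lambda>x. (cmod (h (g x)) ^ n)\<^sup>2) \<longlongrightarrow> (1 ^ n)\<^sup>2) F"
    by (intro tendsto_intros peak)
  then have "eventually (\<lambda>x. (cmod (h (g x)) ^ n)\<^sup>2 > 1 / 2) F"
    by (rule order_tendstoD) simp
  with small have "eventually (\<lambda>x. False) F"
  proof eventually_elim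
    case (elim x)
    have "(1 / \<delta>) * (1 / 2) \<le> (1 / \<delta>) * (cmod (h (g x) ^ n))\<^sup>2"
      using elim(2) \<delta> by (intro mult_left_mono) (auto simp: norm_power)
    then have "\<bar>M\<bar> + 1 \<le> (1 / \<delta>) * (cmod (h (g x) ^ n))\<^sup>2"
      by (simp add: \<delta>_def)
    moreover have "ereal ((1 / \<delta>) * (cmod (h (g x) ^ n))\<^sup>2) < ereal M"
      using ge elim(1) by (rule le_less_trans)
    ultimately show False by simp
  qed
  with F show False by (simp add: eventually_False)
qed

lemma holomorphic_coordinate: "holomorphic_several_on (\<lambda>z. c * z $ i) D"
  unfolding holomorphic_several_on_def
proof
  fix z :: "complex ^ 'a"
  have nth: "((\<lambda>z::complex^'a. z $ i) has_derivative (\<lambda>v. v $ i)) (at z)"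
    by (rule bounded_linear_imp_has_derivative) (rule bounded_linear_vec_nth)
  show "\<exists>g'. ((\<lambda>z. c * z $ i) has_derivative g') (at z) \<and> (\<forall>c v. g' (c *s v) = c * g' v)"
    by (intro exI conjI, rule has_derivative_mult_right[OF nth]) auto
qed

lemma Limsup_bergman_kernel_coordinate:
  assumes D: "open D" "bounded D" and less: "\<And>z. z \<in> D \<Longrightarrow> cmod (z $ i) < 1"
    and a: "a \<in> frontier D" "cmod (a $ i) = 1"
  shows "Limsup (at a within D) (bergman_kernel D) = \<infinity>"
proof (rule Limsup_bergman_kernel_eq_infinity[OF D, where h = "\<lambda>z. 1 * z $ i"])
  show "holomorphic_several_on (\<lambda>z. 1 * z $ i) D" by (rule holomorphic_coordinate)
  show "cmod (1 * z $ i) < 1" if "z \<in> D" for z using less[OF that] by simp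
  show notin: "a \<notin> D" using less[of a] a by auto
  have "a islimpt D"
    using a notin by (auto simp: frontier_def closure_def)
  then show "at a within D \<noteq> bot" by (simp add: trivial_limit_within)
  show "((\<lambda>z. z) \<longlongrightarrow> a) (at a within D)" by (rule tendsto_ident_at)
  show "eventually (\<lambda>z. z \<in> D) (at a within D)" by (simp add: eventually_at_filter)
  have "((\<lambda>z. cmod (1 * z $ i)) \<longlongrightarrow> cmod (1 * a $ i)) (at a within D)"
    by (intro tendsto_intros)
  with a show "((\<lambda>z. cmod (1 * z $ i)) \<longlongrightarrow> 1) (at a within D)" by simp
qed

section \<open>The slit bidisc\<close>

definition pair2 :: "complex \<Rightarrow> complex \<Rightarrow> complex ^ 2" where
  "pair2 x y = (\<chi> i. if i = 1 then x else y)"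

lemma pair2_nth [simp]: "pair2 x y $ 1 = x" "pair2 x y $ 2 = y"
  by (simp_all add: pair2_def)

lemma pair2_eta [simp]: "pair2 (z $ 1) (z $ 2) = z"
  by (simp add: vec_eq_iff pair2_def forall_2)

lemma tendsto_pair2 [tendsto_intros]:
  assumes "(f \<longlongrightarrow> x) F" "(g \<longlongrightarrow> y) F"
  shows "((\<lambda>t. pair2 (f t) (g t)) \<longlongrightarrow> pair2 x y) F"
  unfolding pair2_def using assms by (intro tendsto_vec_lambda) auto

lemma continuous_on_pair2 [continuous_intros]:
  assumes "continuous_on S f" "continuous_on S g"
  shows "continuous_on S (\<lambda>t. pair2 (f t) (g t))"
  using assms unfolding continuous_on_def by (auto intro: tendsto_pair2)

definition slit_bidisc :: "(complex ^ 2) set" where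
  "slit_bidisc = {z. cmod (z $ 1) < 1 \<and> cmod (z $ 2) < 1 \<and>
                     z $ 1 \<noteq> of_real (cmod (z $ 1)) * cis ((cmod (z $ 2))\<^sup>2)}"

lemma open_slit_bidisc: "open slit_bidisc"
  unfolding slit_bidisc_def cis_conv_exp
  by (intro open_Collect_conj open_Collect_less open_Collect_neq continuous_intros)

lemma bounded_slit_bidisc: "bounded slit_bidisc"
proof (rule boundedI)
  fix z assume "z \<in> slit_bidisc"
  then have "(\<Sum>i\<in>UNIV. norm (z $ i)) \<le> 2"
    by (simp add: slit_bidisc_def sum_2)
  moreover have "norm z \<le> (\<Sum>i\<in>UNIV. norm (z $ i))"
    by (simp add: norm_vec_def L2_set_le_sum)
  ultimately show "norm z \<le> 2" by linarith
qed

text \<open>The height above the slit: the argument of \<open>z\<^sub>1\<close> measured from the slit rather than from the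
  positive real axis. Its jump therefore lies exactly on the removed set.\<close>

definition slit_angle :: "complex ^ 2 \<Rightarrow> real" where
  "slit_angle z = Arg2pi (z $ 1 * cis (- (cmod (z $ 2))\<^sup>2))"

lemma rotated_notin_nonneg_Reals:
  assumes "z \<in> slit_bidisc"
  shows "z $ 1 * cis (- (cmod (z $ 2))\<^sup>2) \<notin> \<real>\<^sub>\<ge>\<^sub>0"
proof
  assume "z $ 1 * cis (- (cmod (z $ 2))\<^sup>2) \<in> \<real>\<^sub>\<ge>\<^sub>0"
  then obtain r where r: "r \<ge> 0" "z $ 1 * cis (- (cmod (z $ 2))\<^sup>2) = of_real r"
    by (auto elim: nonneg_Reals_cases)
  have "z $ 1 = z $ 1 * cis (- (cmod (z $ 2))\<^sup>2) * cis ((cmod (z $ 2))\<^sup>2)"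
    by (simp add: mult.assoc cis_mult)
  then have *: "z $ 1 = of_real r * cis ((cmod (z $ 2))\<^sup>2)"
    using r by simp
  then have "cmod (z $ 1) = r" using r by (simp add: norm_mult)
  with * assms show False by (simp add: slit_bidisc_def)
qed

lemma slit_angle_bounds:
  assumes "z \<in> slit_bidisc"
  shows "0 < slit_angle z" "slit_angle z < 2 * pi"
proof -
  have "slit_angle z \<noteq> 0"
    using rotated_notin_nonneg_Reals[OF assms] unfolding slit_angle_def
    by (auto simp: Arg2pi_eq_0 complex_nonneg_Reals_iff complex_is_Real_iff)
  then show "0 < slit_angle z"
    using Arg2pi_ge_0 unfolding slit_angle_def by (metis less_eq_real_def)
  show "slit_angle z < 2 * pi"
    using Arg2pi_lt_2pi unfolding slit_angle_def .
qed

lemma slit_angle_polar: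
  "z $ 1 = of_real (cmod (z $ 1)) * cis ((cmod (z $ 2))\<^sup>2 + slit_angle z)"
proof -
  have "z $ 1 * cis (- (cmod (z $ 2))\<^sup>2) = of_real (cmod (z $ 1)) * cis (slit_angle z)"
    using Arg2pi_eq[of "z $ 1 * cis (- (cmod (z $ 2))\<^sup>2)"]
    by (simp add: slit_angle_def cis_conv_exp norm_mult)
  then have "z $ 1 * cis (- (cmod (z $ 2))\<^sup>2) * cis ((cmod (z $ 2))\<^sup>2)
      = of_real (cmod (z $ 1)) * cis (slit_angle z) * cis ((cmod (z $ 2))\<^sup>2)"
    by simp
  then show ?thesis by (simp add: mult.assoc cis_mult add.commute)
qed

lemma slit_angle_pair2:
  assumes "0 < r" "0 \<le> s" "s < 2 * pi"
  shows "slit_angle (pair2 (of_real r * cis ((cmod y)\<^sup>2 + s)) y) = s"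
  unfolding slit_angle_def using assms
  by (intro Arg2pi_unique[of r]) (simp_all add: mult.assoc cis_mult cis_conv_exp[symmetric])

lemma pair2_polar_mem_slit_bidisc:
  assumes "0 < r" "r < 1" "0 < s" "s < 2 * pi" "cmod y < 1"
  shows "pair2 (of_real r * cis ((cmod y)\<^sup>2 + s)) y \<in> slit_bidisc" (is "?z \<in> _")
proof -
  have norm: "cmod (?z $ 1) = r" using assms by (simp add: norm_mult)
  have "slit_angle ?z = s" using assms by (simp add: slit_angle_pair2)
  moreover have "slit_angle (pair2 (of_real r * cis ((cmod y)\<^sup>2 + 0)) y) = 0"
    using assms by (intro slit_angle_pair2) auto
  ultimately have "of_real r * cis ((cmod y)\<^sup>2 + s) \<noteq> of_real r * cis ((cmod y)\<^sup>2)"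
    using assms by auto
  then show ?thesis using assms norm by (simp add: slit_bidisc_def norm_mult)
qed

text \<open>Polar coordinates with the angle measured from the slit straighten the domain to a product of
  two intervals and a disc.\<close>

lemma connected_slit_bidisc: "connected slit_bidisc"
proof -
  let ?S = "{0<..<1::real} \<times> {0<..<2 * pi} \<times> ball (0::complex) 1"
  let ?P = "\<lambda>(r, s, y). pair2 (of_real r * cis ((cmod y)\<^sup>2 + s)) y"
  have "connected ?S"
    by (intro connected_Times) auto
  moreover have "continuous_on ?S ?P"
    unfolding case_prod_beta cis_conv_exp by (intro continuous_intros)
  ultimately have "connected (?P ` ?S)"
    by (intro connected_continuous_image)
  also have "?P ` ?S = slit_bidisc"
  proof (intro equalityI subsetI)
    fix z assume z: "z \<in> slit_bidisc"
    have "z $ 1 \<noteq> 0" using z by (auto simp: slit_bidisc_def)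
    then have "(cmod (z $ 1), slit_angle z, z $ 2) \<in> ?S"
      using z slit_angle_bounds[OF z] by (auto simp: slit_bidisc_def)
    moreover have "z = ?P (cmod (z $ 1), slit_angle z, z $ 2)"
      by (simp flip: slit_angle_polar)
    ultimately show "z \<in> ?P ` ?S" by blast
  qed (auto intro!: pair2_polar_mem_slit_bidisc)
  finally show ?thesis .
qed

section \<open>Peak functions along the slit\<close>

text \<open>A continuous logarithm is differentiable because near a point it differs from the principal
  logarithm of the quotient by a constant.\<close>

lemma has_derivative_continuous_log:
  fixes q f :: "'a::real_normed_vector \<Rightarrow> complex"
  assumes U: "open U" "z \<in> U" and q: "continuous_on U q" and log: "\<And>x. x \<in> U \<Longrightarrow> exp (q x) = f x"
    and f: "(f has_derivative f') (at z)"
  shows "(q has_derivative (\<lambda>v. f' v / f z)) (at z)"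
proof -
  have fz: "f z \<noteq> 0" using log[OF U(2)] by (metis exp_not_eq_zero)
  have 1: "f z / f z \<notin> \<real>\<^sub>\<le>\<^sub>0" using fz by simp
  have "((\<lambda>x. Ln (f x / f z)) has_derivative (\<lambda>v. f' v / f z)) (at z)"
  proof -
    have d: "((\<lambda>x. f x / f z) has_derivative (\<lambda>v. f' v / f z)) (at z)"
      using bounded_linear.has_derivative[OF bounded_linear_divide f] .
    have "(Ln has_field_derivative inverse (f z / f z)) (at (f z / f z))"
      using 1 by (rule has_field_derivative_Ln)
    from has_derivative_compose[OF d, OF this[unfolded has_field_derivative_def]]
    show ?thesis using fz by simp
  qed
  then have der: "((\<lambda>x. Ln (f x / f z) + q z) has_derivative (\<lambda>v. f' v / f z)) (at z)"
    by (auto intro!: derivative_eq_intros)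
  have "isCont q z" using q U continuous_on_eq_continuous_at by blast
  then have "((\<lambda>x. Im (q x)) \<longlongrightarrow> Im (q z)) (at z)"
    unfolding isCont_def by (rule tendsto_Im)
  then have "eventually (\<lambda>x. dist (Im (q x)) (Im (q z)) < pi) (at z)"
    by (rule tendstoD) simp
  moreover have "eventually (\<lambda>x. x \<in> U) (at z)"
    using U by (simp add: eventually_at_topological) blast
  ultimately have "eventually (\<lambda>x. Ln (f x / f z) + q z = q x) (at z)"
  proof eventually_elim
    case (elim x)
    have "f x / f z = exp (q x - q z)"
      using elim log U by (simp add: exp_diff)
    moreover have "Ln (exp (q x - q z)) = q x - q z"
      using elim(1) by (intro Ln_exp) (auto simp: dist_real_def)
    ultimately show ?case by simp
  qed
  then show ?thesis
    using fz by (intro has_derivative_transform_eventually[OF der]) auto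
qed

definition slit_log :: "complex ^ 2 \<Rightarrow> complex" where
  "slit_log z = Complex (ln (cmod (z $ 1))) ((cmod (z $ 2))\<^sup>2 + slit_angle z)"

lemma exp_slit_log:
  assumes "z \<in> slit_bidisc"
  shows "exp (slit_log z) = z $ 1"
proof -
  have "z $ 1 \<noteq> 0" using assms by (auto simp: slit_bidisc_def)
  then show ?thesis
    using slit_angle_polar[of z]
    by (simp add: slit_log_def exp_eq_polar exp_of_real)
qed

lemma continuous_on_slit_log: "continuous_on slit_bidisc slit_log"
proof -
  have "continuous_on slit_bidisc (\<lambda>z. Arg2pi (z $ 1 * cis (- (cmod (z $ 2))\<^sup>2)))"
  proof (rule continuous_on_compose2[where g = Arg2pi])
    show "continuous_on (- \<real>\<^sub>\<ge>\<^sub>0) Arg2pi"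
      by (auto intro!: continuous_at_imp_continuous_on continuous_at_Arg2pi)
    show "continuous_on slit_bidisc (\<lambda>z. z $ 1 * cis (- (cmod (z $ 2))\<^sup>2))"
      unfolding cis_conv_exp by (intro continuous_intros)
  qed (use rotated_notin_nonneg_Reals in auto)
  moreover have "\<And>z. z \<in> slit_bidisc \<Longrightarrow> z $ 1 \<noteq> 0" by (auto simp: slit_bidisc_def)
  ultimately show ?thesis
    unfolding slit_log_def slit_angle_def Complex_eq by (intro continuous_intros) auto
qed

text \<open>With \<open>w = log z\<^sub>1\<close>, the lower end of the domain is \<open>Im w > \<bar>z\<^sub>2\<bar>\<^sup>2\<close>, and the tangent plane of this
  convex region over \<open>z\<^sub>2 = b\<close> is where \<open>Re (\<i> w + 2 (cnj b) z\<^sub>2 - \<bar>b\<bar>\<^sup>2) = 0\<close>. Exponentiating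
  the expression in parentheses gives a function of modulus below one above that plane.\<close>

definition slit_peak :: "complex \<Rightarrow> complex ^ 2 \<Rightarrow> complex" where
  "slit_peak b z = exp (\<i> * slit_log z + 2 * cnj b * z $ 2 - of_real ((cmod b)\<^sup>2))"

lemma holomorphic_slit_peak: "holomorphic_several_on (slit_peak b) slit_bidisc"
  unfolding holomorphic_several_on_def
proof
  fix z assume z: "z \<in> slit_bidisc"
  have nth: "((\<lambda>z::complex^2. z $ i) has_derivative (\<lambda>v. v $ i)) (at z)" for i
    by (rule bounded_linear_imp_has_derivative) (rule bounded_linear_vec_nth)
  have log: "(slit_log has_derivative (\<lambda>v. v $ 1 / z $ 1)) (at z)"
    by (rule has_derivative_continuous_log[OF open_slit_bidisc z continuous_on_slit_log exp_slit_log nth])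
  have "((\<lambda>z. \<i> * slit_log z + 2 * cnj b * z $ 2 - of_real ((cmod b)\<^sup>2)) has_derivative
      (\<lambda>v. \<i> * (v $ 1 / z $ 1) + 2 * cnj b * v $ 2 - 0)) (at z)"
    by (intro has_derivative_diff has_derivative_add has_derivative_mult_right log nth
          has_derivative_const)
  from has_derivative_compose[OF this, OF DERIV_exp[unfolded has_field_derivative_def]] have "(slit_peak b has_derivative
      (\<lambda>v. slit_peak b z * (\<i> * (v $ 1 / z $ 1) + 2 * cnj b * v $ 2))) (at z)"
    by (simp add: slit_peak_def[abs_def] mult.commute)
  then show "\<exists>g'. (slit_peak b has_derivative g') (at z) \<and> (\<forall>c v. g' (c *s v) = c * g' v)"
    by (intro exI conjI) (auto simp: algebra_simps)
qed

text \<open>The square completes because the real part of \<open>\<i> log z\<^sub>1\<close> contributes \<open>- \<bar>z\<^sub>2\<bar>\<^sup>2\<close> in addition to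
  minus the height above the slit.\<close>

lemma norm_slit_peak:
  "cmod (slit_peak b z) = exp (- slit_angle z - (cmod (z $ 2 - b))\<^sup>2)"
  unfolding slit_peak_def norm_exp_eq_Re
  by (simp add: slit_log_def cmod_power2) (simp add: power2_eq_square algebra_simps)

text \<open>The point is approached over the fixed value \<open>z\<^sub>2 = b\<close>, by letting the height \<open>s\<close> above the
  slit decrease to zero; the peak function then has modulus \<open>exp (- s)\<close>.\<close>

lemma Limsup_bergman_kernel_slit:
  assumes a: "cmod (a $ 1) < 1" "cmod (a $ 2) < 1"
    "a $ 1 = of_real (cmod (a $ 1)) * cis ((cmod (a $ 2))\<^sup>2)"
  shows "Limsup (at a within slit_bidisc) (bergman_kernel slit_bidisc) = \<infinity>"
proof -
  define \<rho> b where "\<rho> = cmod (a $ 1)" and "b = a $ 2"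
  \<comment> \<open>The radius is moved towards 1/2 so that it stays positive when the slit point has \<open>z\<^sub>1 = 0\<close>.\<close>
  define r where "r s = (1 - s) * \<rho> + s / 2" for s
  define g where "g s = pair2 (of_real (r s) * cis ((cmod b)\<^sup>2 + s)) b" for s
  have \<rho>: "0 \<le> \<rho>" "\<rho> < 1" using a by (auto simp: \<rho>_def)
  have ev: "eventually (\<lambda>s. 0 < s \<and> s < 1) (at_right (0::real))"
    by (intro eventually_conj eventually_at_right_less) (auto simp: eventually_at_right[of 0 1] intro: exI[of _ 1])
  have r: "0 < r s \<and> r s < 1" if "0 < s" "s < 1" for s
  proof -
    have "(1 - s) * \<rho> \<le> 1 - s" "0 \<le> (1 - s) * \<rho>" using that \<rho> by (auto intro: mult_left_le)
    then show ?thesis using that unfolding r_def by linarith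
  qed
  have pi: "1 < 2 * pi" using pi_gt3 by simp
  show ?thesis
  proof (rule Limsup_bergman_kernel_eq_infinity[OF open_slit_bidisc bounded_slit_bidisc
           holomorphic_slit_peak[of b], where F = "at_right (0::real)" and g = g])
    show "cmod (slit_peak b z) < 1" if "z \<in> slit_bidisc" for z
      proof -
      have "- slit_angle z - (cmod (z $ 2 - b))\<^sup>2 < 0"
        using slit_angle_bounds(1)[OF that] zero_le_power2[of "cmod (z $ 2 - b)"] by linarith
      then show ?thesis unfolding norm_slit_peak by simp
    qed
    have "(g \<longlongrightarrow> pair2 (of_real (r 0) * cis ((cmod b)\<^sup>2 + 0)) b) (at_right 0)"
      unfolding g_def r_def cis_conv_exp by (intro tendsto_intros) simp_all
    also have "pair2 (of_real (r 0) * cis ((cmod b)\<^sup>2 + 0)) b = a"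
      using a(3) pair2_eta[of a] by (simp add: r_def \<rho>_def b_def)
    finally show "(g \<longlongrightarrow> a) (at_right 0)" .
    show "eventually (\<lambda>s. g s \<in> slit_bidisc) (at_right 0)"
      using ev by eventually_elim (use r a pi in \<open>auto simp: g_def b_def intro!: pair2_polar_mem_slit_bidisc\<close>)
    have "((\<lambda>s. exp (- s)) \<longlongrightarrow> exp (- 0)) (at_right (0::real))"
      by (intro tendsto_intros)
    moreover have "eventually (\<lambda>s. exp (- s) = cmod (slit_peak b (g s))) (at_right 0)"
      using ev
    proof eventually_elim
      case (elim s)
      then have "slit_angle (g s) = s"
        unfolding g_def using r[of s] pi by (intro slit_angle_pair2) auto
      then show ?case by (simp add: norm_slit_peak g_def)
    qed
    ultimately show "((\<lambda>s. cmod (slit_peak b (g s))) \<longlongrightarrow> 1) (at_right 0)"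
      using Lim_transform_eventually by fastforce
    show "a \<notin> slit_bidisc" using a by (simp add: slit_bidisc_def)
  qed simp
qed

lemma Limsup_bergman_kernel_slit_bidisc:
  assumes "a \<in> frontier slit_bidisc"
  shows "Limsup (at a within slit_bidisc) (bergman_kernel slit_bidisc) = \<infinity>"
proof -
  have "closed {z :: complex ^ 2. cmod (z $ 1) \<le> 1 \<and> cmod (z $ 2) \<le> 1}"
    by (intro closed_Collect_conj closed_Collect_le continuous_intros)
  then have "closure slit_bidisc \<subseteq> {z. cmod (z $ 1) \<le> 1 \<and> cmod (z $ 2) \<le> 1}"
    by (intro closure_minimal) (auto simp: slit_bidisc_def)
  moreover have "a \<in> closure slit_bidisc" "a \<notin> slit_bidisc"
    using assms open_slit_bidisc by (auto simp: frontier_def interior_open)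
  ultimately have le: "cmod (a $ 1) \<le> 1" "cmod (a $ 2) \<le> 1" and notin: "a \<notin> slit_bidisc"
    by auto
  show ?thesis
  proof (cases "\<exists>i. cmod (a $ i) = 1")
    case True
    then obtain i where i: "cmod (a $ i) = 1" ..
    have "cmod (z $ i) < 1" if "z \<in> slit_bidisc" for z
      using that exhaust_2[of i] by (auto simp: slit_bidisc_def)
    then show ?thesis
      using i assms by (intro Limsup_bergman_kernel_coordinate open_slit_bidisc bounded_slit_bidisc)
  next
    case False
    then have "cmod (a $ 1) < 1" "cmod (a $ 2) < 1" using le by (auto simp: less_le)
    with notin show ?thesis
      by (intro Limsup_bergman_kernel_slit) (auto simp: slit_bidisc_def)
  qed
qed

section \<open>Failure of pseudoconvexity\<close>

text \<open>The maximum principle at the centre of an affine disc, which the sub-mean value inequality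
  gives directly.\<close>

lemma continuous_plurisubharmonic_on_centre_le:
  assumes u: "continuous_plurisubharmonic_on u D" and "r > 0"
    and disc: "\<And>\<tau>. cmod \<tau> \<le> r \<Longrightarrow> z + \<tau> *s w \<in> D"
    and C: "\<And>\<tau>. cmod \<tau> = r \<Longrightarrow> u (z + \<tau> *s w) \<le> C"
  shows "u z \<le> C"
proof -
  define v where "v \<tau> = u (z + \<tau> *s w)" for \<tau>
  let ?U = "{\<tau>. z + \<tau> *s w \<in> D}"
  have sub: "continuous_subharmonic_on v ?U"
    using u unfolding continuous_plurisubharmonic_on_def v_def by blast
  have cball: "cball 0 r \<subseteq> ?U" using disc by auto
  have v0: "v 0 \<le> integral {0..2 * pi} (\<lambda>t. v (0 + of_real r * cis t)) / (2 * pi)"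
    using sub \<open>r > 0\<close> cball unfolding continuous_subharmonic_on_def by blast
  have "continuous_on {0..2 * pi} (\<lambda>t. v (0 + of_real r * cis t))"
  proof (rule continuous_on_compose2[where g = v])
    show "continuous_on ?U v" using sub by (simp add: continuous_subharmonic_on_def)
    show "continuous_on {0..2 * pi} (\<lambda>t. 0 + of_real r * cis t)"
      unfolding cis_conv_exp by (intro continuous_intros)
    show "(\<lambda>t. 0 + of_real r * cis t) ` {0..2 * pi} \<subseteq> ?U"
      using \<open>r > 0\<close> by (auto intro!: disc simp: norm_mult)
  qed
  then have "integral {0..2 * pi} (\<lambda>t. v (0 + of_real r * cis t)) \<le> integral {0..2 * pi} (\<lambda>t. C)"
    using \<open>r > 0\<close> by (intro integral_le integrable_continuous_interval)
      (auto intro!: C simp: v_def norm_mult)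
  then have "integral {0..2 * pi} (\<lambda>t. v (0 + of_real r * cis t)) / (2 * pi) \<le> C"
    by (simp add: field_simps)
  with v0 show ?thesis by (simp add: v_def)
qed

lemma not_pseudoconvex_slit_bidisc: "\<not> pseudoconvex slit_bidisc"
proof
  assume "pseudoconvex slit_bidisc"
  then obtain u where u: "continuous_plurisubharmonic_on u slit_bidisc"
    and exh: "\<And>c. closure {z \<in> slit_bidisc. u z < c} \<subseteq> slit_bidisc"
    unfolding pseudoconvex_def by blast
  define p where "p t = of_real (1 / 2) * cis (- t)" for t :: real
  \<comment> \<open>The slit leaves the positive real axis with increasing \<open>\<bar>z\<^sub>2\<bar>\<close> in the direction of positive
    arguments, so points of argument \<open>- t\<close> miss it, as does the limit \<open>t = 0\<close> off the centre.\<close>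
  have off: "pair2 (p t) y \<in> slit_bidisc" if "0 \<le> t" "t \<le> 1" "cmod y \<le> 1 / 2" "0 < t \<or> y \<noteq> 0" for t y
  proof -
    have y: "(cmod y)\<^sup>2 \<le> 1"
      using that by (auto intro: power_le_one)
    have "cis ((cmod y)\<^sup>2 + t) \<noteq> 1"
    proof
      assume "cis ((cmod y)\<^sup>2 + t) = 1"
      moreover have "0 < (cmod y)\<^sup>2 + t"
        using that by (auto intro: add_nonneg_pos add_pos_nonneg)
      moreover have "(cmod y)\<^sup>2 + t < 2 * pi"
        using y that pi_gt3 by linarith
      ultimately show False
        using Arg2pi_unique[of 1 "(cmod y)\<^sup>2 + t" 1] Arg2pi_of_real[of 1] by (simp add: cis_conv_exp)
    qed
    moreover have "cis ((cmod y)\<^sup>2 + t) = cis ((cmod y)\<^sup>2) / cis (- t)"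
      by (simp add: cis_divide)
    ultimately have "cis (- t) \<noteq> cis ((cmod y)\<^sup>2)"
      by auto
    then show ?thesis
      using that by (simp add: slit_bidisc_def p_def norm_mult)
  qed
  \<comment> \<open>The circles bounding the discs, including the limiting one.\<close>
  define K where "K = (\<lambda>(t, y). pair2 (p t) y) ` ({0..1} \<times> sphere 0 (1 / 2))"
  have "compact K"
    unfolding K_def case_prod_beta p_def cis_conv_exp
    by (intro compact_continuous_image compact_Times continuous_intros) auto
  moreover have "K \<subseteq> slit_bidisc"
    unfolding K_def by (auto intro!: off)
  moreover have "continuous_on slit_bidisc u"
    using u by (simp add: continuous_plurisubharmonic_on_def)
  ultimately have "compact (u ` K)"
    by (blast intro: compact_continuous_image continuous_on_subset)
  then obtain C where C: "\<And>z. z \<in> K \<Longrightarrow> u z \<le> C"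
    using compact_imp_bounded[of "u ` K"] unfolding bounded_real by (auto simp: abs_le_iff)
  \<comment> \<open>The centres lie in one sublevel set, whose closure would have to stay inside the domain.\<close>
  have centre: "pair2 (p t) 0 \<in> {z \<in> slit_bidisc. u z < C + 1}" if "0 < t" "t \<le> 1" for t
  proof -
    have line: "pair2 (p t) 0 + \<tau> *s pair2 0 1 = pair2 (p t) \<tau>" for \<tau>
      by (simp add: vec_eq_iff forall_2)
    have "u (pair2 (p t) 0) \<le> C"
    proof (rule continuous_plurisubharmonic_on_centre_le[OF u, where r = "1 / 2" and w = "pair2 0 1"])
      show "pair2 (p t) 0 + \<tau> *s pair2 0 1 \<in> slit_bidisc" if "cmod \<tau> \<le> 1 / 2" for \<tau>
        unfolding line using that \<open>0 < t\<close> \<open>t \<le> 1\<close> by (intro off) auto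
      show "u (pair2 (p t) 0 + \<tau> *s pair2 0 1) \<le> C" if "cmod \<tau> = 1 / 2" for \<tau>
        unfolding line using that \<open>0 < t\<close> \<open>t \<le> 1\<close> by (intro C) (force simp: K_def)
    qed simp
    then show ?thesis using that off[of t 0] by auto
  qed
  have "((\<lambda>t. pair2 (p t) 0) \<longlongrightarrow> pair2 (p 0) 0) (at_right 0)"
    unfolding p_def cis_conv_exp by (intro tendsto_intros)
  moreover have "eventually (\<lambda>t. pair2 (p t) 0 \<in> closure {z \<in> slit_bidisc. u z < C + 1}) (at_right 0)"
    unfolding eventually_at_right[of 0 "1::real", simplified]
    using centre closure_subset by (intro exI[of _ 1]) fastforce
  ultimately have "pair2 (p 0) 0 \<in> closure {z \<in> slit_bidisc. u z < C + 1}"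
    by (intro Lim_in_closed_set[OF closed_closure]) auto
  then have "pair2 (p 0) 0 \<in> slit_bidisc" using exh by blast
  then show False by (simp add: slit_bidisc_def p_def)
qed

theorem proposition5:
  "\<exists>D :: (complex ^ 2) set. is_domain D \<and> bounded D \<and> \<not> pseudoconvex D \<and>
     (\<forall>a \<in> frontier D. Limsup (at a within D) (bergman_kernel D) = \<infinity>)"
  by (intro exI[of _ slit_bidisc] conjI ballI Limsup_bergman_kernel_slit_bidisc
        bounded_slit_bidisc not_pseudoconvex_slit_bidisc)
     (simp add: is_domain_def open_slit_bidisc connected_slit_bidisc)

end
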